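(* Let $\mathcal{R}'=\{\beta,\mu,\mu',\rho,\varepsilon\}$. The set $\mathcal{WN}_{\mathcal{R}'}\cap\mathcal{T}_t$ is saturated.
   Context: $\lambda\mu$-terms: $\mathcal{T} ::= x \mid \lambda x.\mathcal{T} \mid (\mathcal{T})\mathcal{T} \mid [\alpha]\mathcal{T} \mid \mu\alpha.\mathcal{T}$, up to renaming of bound variables; substitutions avoid capture. Types $A ::= X \mid \bot \mid A\to B$; typing judgments $\Gamma\vdash M:A;\Theta$ by: $\Gamma,x:A\vdash x:A;\Theta$; from $\Gamma,x:A\vdash M:B;\Theta$ infer $\Gamma\vdash\lambda x.M:A\to B;\Theta$; from $\Gamma\vdash M:A\to B;\Theta$, $\Gamma\vdash N:A;\Theta$ infer $\Gamma\vdash(M)N:B;\Theta$; from $\Gamma\vdash M:A;\alpha:A,\Theta$ infer $\Gamma\vdash[\alpha]M:\bot;\alpha:A,\Theta$; from $\Gamma\vdash M:\bot;\alpha:A,\Theta$ infer $\Gamma\vdash\mu\alpha.M:A;\Theta$. $\mathcal{T}_t$ = typable terms. $(M)P_1\dots P_k=(\dots((M)P_1)\dots)P_k$; $\mathcal{L}^{<\omega}$ = finite sequences from $\mathcal{L}$. $M[\alpha:=\beta]$ renames; $M[\alpha:=_rN]$ (resp. $M[\alpha:=_lN]$) replaces inductively each $[\alpha]P$ by $[\alpha](P')N$ (resp. $[\alpha](N)P'$); $M[\alpha:=_rN_1\dots N_n]=M[\alpha:=_rN_1]\dots[\alpha:=_rN_n]$; $M_\alpha$ replaces inductively each $[\alpha]P$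 by $P$. Rules: $\beta$: $(\lambda x.M)N\to M[x:=N]$; $\mu$: $(\mu\alpha.M)N\to\mu\alpha.M[\alpha:=_rN]$; $\mu'$: $(N)\mu\alpha.M\to\mu\alpha.M[\alpha:=_lN]$; $\rho$: $[\beta]\mu\alpha.M\to M[\alpha:=\beta]$; $\varepsilon$: $\mu\alpha.\mu\beta.M\to\mu\alpha.M_\beta$. $\mathcal{WN}_{\mathcal{R}'}$: terms reducing (one redex contracted per step, anywhere) to a term with no $\mathcal{R}'$-redex. Saturated set: $\mathcal{B}\subseteq\mathcal{T}_t$ with (C1) $M\in\mathcal{B}\Rightarrow\lambda x.M\in\mathcal{B}$; (C2) $M\in\mathcal{B}$, $\mu\alpha.M\in\mathcal{T}_t\Rightarrow\mu\alpha.M\in\mathcal{B}$; (C3) $M\in\mathcal{B}$, $[\alpha]M\in\mathcal{T}_t\Rightarrow[\alpha]M\in\mathcal{B}$; (C4) $n\ge0$, $N_1,\dots,N_n\in\mathcal{B}$, $(x)N_1\dots N_n\in\mathcal{T}_t\Rightarrow(x)N_1\dots N_n\in\mathcal{B}$; (C5) $M,N\in\mathcal{T}_t$, $\bar P\in\mathcal{T}_t^{<\omega}$, $N\in\mathcal{B}$, $(\lambda x.M)N\bar P\in\mathcal{T}_t$, $(M[x:=N])\bar P\in\mathcal{B}\Rightarrow(\lambda x.M)N\bar P\in\mathcal{B}$; (C6) $M\in\mathcal{T}_t$, $\bar N\in\mathcal{B}^{<\omega}$, $(\mu\alpha.M)\bar N\in\mathcal{T}_t$, $\mu\alpha.M[\alpha:=_r\bar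 N]\in\mathcal{B}\Rightarrow(\mu\alpha.M)\bar N\in\mathcal{B}$. *)

theory Defs
  imports Main
begin

text \<open>
  Terms up to renaming of bound variables are represented with de Bruijn indices, separately
  for \<open>\<lambda>\<close>-variables and \<open>\<mu>\<close>-variables. Index \<open>i\<close> occurring free at top level is
  the \<open>i\<close>-th variable, so de Bruijn terms are in bijection with \<open>\<alpha>\<close>-classes of named terms.
  The operators \<open>lam\<close> and \<open>mu\<close> below are the named binders \<open>\<lambda>x.M\<close> and \<open>\<mu>\<alpha>.M\<close>: they turn the
  given free variable of \<open>M\<close> into a bound one and leave the other free variables unchanged.
\<close>

datatype trm =
    Var nat
  | Lam trm
  | App trm trm
  | Nam nat trm  \<comment> \<open>\<open>[\<alpha>]M\<close>\<close>
  | Mu trm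

definition up :: "(nat \<Rightarrow> nat) \<Rightarrow> nat \<Rightarrow> nat" where
  "up f = case_nat 0 (\<lambda>i. Suc (f i))"

text \<open>Renaming of the free \<open>\<lambda>\<close>-variables by \<open>f\<close> and of the free \<open>\<mu>\<close>-variables by \<open>g\<close>.\<close>

primrec ren :: "(nat \<Rightarrow> nat) \<Rightarrow> (nat \<Rightarrow> nat) \<Rightarrow> trm \<Rightarrow> trm" where
  "ren f g (Var x) = Var (f x)"
| "ren f g (Lam M) = Lam (ren (up f) g M)"
| "ren f g (App M N) = App (ren f g M) (ren f g N)"
| "ren f g (Nam a M) = Nam (g a) (ren f g M)"
| "ren f g (Mu M) = Mu (ren f (up g) M)"

abbreviation shift_var :: "trm \<Rightarrow> trm" where
  "shift_var \<equiv> ren Suc id"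

abbreviation shift_mvar :: "trm \<Rightarrow> trm" where
  "shift_mvar \<equiv> ren id Suc"

primrec free_mvars :: "trm \<Rightarrow> nat set" where
  "free_mvars (Var x) = {}"
| "free_mvars (Lam M) = free_mvars M"
| "free_mvars (App M N) = free_mvars M \<union> free_mvars N"
| "free_mvars (Nam a M) = insert a (free_mvars M)"
| "free_mvars (Mu M) = {a. Suc a \<in> free_mvars M}"

definition abstr :: "nat \<Rightarrow> nat \<Rightarrow> nat" where
  "abstr x y = (if y = x then 0 else Suc y)"

definition lam :: "nat \<Rightarrow> trm \<Rightarrow> trm" where
  "lam x M = Lam (ren (abstr x) id M)"

definition mu :: "nat \<Rightarrow> trm \<Rightarrow> trm" where
  "mu a M = Mu (ren id (abstr a) M)"

definition apps :: "trm \<Rightarrow> trm list \<Rightarrow> trm" where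
  "apps M Ps = foldl App M Ps"

text \<open>Capture-avoiding simultaneous substitution for the free \<open>\<lambda>\<close>-variables.\<close>

primrec sub :: "(nat \<Rightarrow> trm) \<Rightarrow> trm \<Rightarrow> trm" where
  "sub s (Var x) = s x"
| "sub s (Lam M) = Lam (sub (case_nat (Var 0) (\<lambda>i. shift_var (s i))) M)"
| "sub s (App M N) = App (sub s M) (sub s N)"
| "sub s (Nam a M) = Nam a (sub s M)"
| "sub s (Mu M) = Mu (sub (\<lambda>i. shift_mvar (s i)) M)"

text \<open>\<open>M[x:=N]\<close> and \<open>M[\<alpha>:=\<beta>]\<close>.\<close>

definition subst :: "trm \<Rightarrow> nat \<Rightarrow> trm \<Rightarrow> trm" where
  "subst M x N = sub (Var(x := N)) M"

definition rename_mvar :: "trm \<Rightarrow> nat \<Rightarrow> nat \<Rightarrow> trm" where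
  "rename_mvar M a b = ren id (id(a := b)) M"

text \<open>\<open>M[\<alpha>:=\<^sub>rN]\<close>, \<open>M[\<alpha>:=\<^sub>lN]\<close> and \<open>M\<^sub>\<alpha>\<close>.\<close>

primrec msubst_r :: "trm \<Rightarrow> nat \<Rightarrow> trm \<Rightarrow> trm" where
  "msubst_r (Var x) a N = Var x"
| "msubst_r (Lam M) a N = Lam (msubst_r M a (shift_var N))"
| "msubst_r (App M P) a N = App (msubst_r M a N) (msubst_r P a N)"
| "msubst_r (Nam b M) a N =
     (if b = a then Nam a (App (msubst_r M a N) N) else Nam b (msubst_r M a N))"
| "msubst_r (Mu M) a N = Mu (msubst_r M (Suc a) (shift_mvar N))"

primrec msubst_l :: "trm \<Rightarrow> nat \<Rightarrow> trm \<Rightarrow> trm" where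
  "msubst_l (Var x) a N = Var x"
| "msubst_l (Lam M) a N = Lam (msubst_l M a (shift_var N))"
| "msubst_l (App M P) a N = App (msubst_l M a N) (msubst_l P a N)"
| "msubst_l (Nam b M) a N =
     (if b = a then Nam a (App N (msubst_l M a N)) else Nam b (msubst_l M a N))"
| "msubst_l (Mu M) a N = Mu (msubst_l M (Suc a) (shift_mvar N))"

definition msubsts_r :: "trm \<Rightarrow> nat \<Rightarrow> trm list \<Rightarrow> trm" where
  "msubsts_r M a Ns = foldl (\<lambda>M N. msubst_r M a N) M Ns"

primrec erase :: "trm \<Rightarrow> nat \<Rightarrow> trm" where
  "erase (Var x) a = Var x"
| "erase (Lam M) a = Lam (erase M a)"
| "erase (App M N) a = App (erase M a) (erase N a)"
| "erase (Nam b M) a = (if b = a then erase M a else Nam b (erase M a))"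
| "erase (Mu M) a = Mu (erase M (Suc a))"


datatype ty = TVar nat | Bot | Arr ty ty

text \<open>\<open>typing \<Gamma> M A \<Theta>\<close> is \<open>\<Gamma> \<turnstile> M : A; \<Theta>\<close>; \<open>case_nat (Some A) \<Gamma>\<close> extends \<open>\<Gamma>\<close> by a
  declaration of the variable bound by index 0.\<close>

inductive typing :: "(nat \<rightharpoonup> ty) \<Rightarrow> trm \<Rightarrow> ty \<Rightarrow> (nat \<rightharpoonup> ty) \<Rightarrow> bool" where
  ty_Var: "\<Gamma> x = Some A \<Longrightarrow> typing \<Gamma> (Var x) A \<Theta>"
| ty_Lam: "typing (case_nat (Some A) \<Gamma>) M B \<Theta> \<Longrightarrow> typing \<Gamma> (Lam M) (Arr A B) \<Theta>"
| ty_App: "typing \<Gamma> M (Arr A B) \<Theta> \<Longrightarrow> typing \<Gamma> N A \<Theta> \<Longrightarrow> typing \<Gamma> (App M N) B \<Theta>"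
| ty_Nam: "typing \<Gamma> M A \<Theta> \<Longrightarrow> \<Theta> a = Some A \<Longrightarrow> typing \<Gamma> (Nam a M) Bot \<Theta>"
| ty_Mu: "typing \<Gamma> M Bot (case_nat (Some A) \<Theta>) \<Longrightarrow> typing \<Gamma> (Mu M) A \<Theta>"

definition typable :: "trm set" where
  "typable = {M. \<exists>\<Gamma> A \<Theta>. finite (dom \<Gamma>) \<and> finite (dom \<Theta>) \<and> typing \<Gamma> M A \<Theta>}"


datatype redrule = Beta | MuR | MuL | Rho | Epsilon

text \<open>
  Contraction of a redex at the root: \<open>MuR\<close> is the rule \<open>\<mu>\<close> and \<open>MuL\<close> the rule \<open>\<mu>'\<close>. In \<open>Beta\<close>,
  \<open>Rho\<close> and \<open>Epsilon\<close> a binder disappears, so \<open>case_nat t s\<close> maps its index 0 to \<open>t\<close> and lowers the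
  others; in \<open>Epsilon\<close> index 0 no longer occurs after erasure, so its image is irrelevant.
  The lemmas \<open>contr_*\<close> below give the rules in terms of the named binders.
\<close>

inductive contr :: "redrule \<Rightarrow> trm \<Rightarrow> trm \<Rightarrow> bool" where
  Beta: "contr Beta (App (Lam M) N) (sub (case_nat N Var) M)"
| MuR: "contr MuR (App (Mu M) N) (Mu (msubst_r M 0 (shift_mvar N)))"
| MuL: "contr MuL (App N (Mu M)) (Mu (msubst_l M 0 (shift_mvar N)))"
| Rho: "contr Rho (Nam b (Mu M)) (ren id (case_nat b id) M)"
| Epsilon: "contr Epsilon (Mu (Mu M)) (Mu (ren id (case_nat 0 id) (erase M 0)))"

inductive step :: "redrule set \<Rightarrow> trm \<Rightarrow> trm \<Rightarrow> bool" for R where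
  root: "r \<in> R \<Longrightarrow> contr r M N \<Longrightarrow> step R M N"
| Lam: "step R M N \<Longrightarrow> step R (Lam M) (Lam N)"
| AppL: "step R M N \<Longrightarrow> step R (App M P) (App N P)"
| AppR: "step R M N \<Longrightarrow> step R (App P M) (App P N)"
| Nam: "step R M N \<Longrightarrow> step R (Nam a M) (Nam a N)"
| Mu: "step R M N \<Longrightarrow> step R (Mu M) (Mu N)"

definition normal :: "redrule set \<Rightarrow> trm \<Rightarrow> bool" where
  "normal R M \<longleftrightarrow> (\<nexists>N. step R M N)"

definition WN :: "redrule set \<Rightarrow> trm set" where
  "WN R = {M. \<exists>N. (step R)\<^sup>*\<^sup>* M N \<and> normal R N}"


text \<open>
  In the last clause the bound variable \<open>\<alpha>\<close> is chosen outside the free variables of the \<open>N\<^sub>i\<close>,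
  which is always possible up to renaming; otherwise \<open>\<mu>\<alpha>\<close> would capture them.
\<close>

definition saturated :: "trm set \<Rightarrow> bool" where
  "saturated B \<longleftrightarrow>
     B \<subseteq> typable \<and>
     (\<forall>x M. M \<in> B \<longrightarrow> lam x M \<in> B) \<and>
     (\<forall>a M. M \<in> B \<longrightarrow> mu a M \<in> typable \<longrightarrow> mu a M \<in> B) \<and>
     (\<forall>a M. M \<in> B \<longrightarrow> Nam a M \<in> typable \<longrightarrow> Nam a M \<in> B) \<and>
     (\<forall>x Ns. Ns \<in> lists B \<longrightarrow> apps (Var x) Ns \<in> typable \<longrightarrow> apps (Var x) Ns \<in> B) \<and>
     (\<forall>x M N Ps. M \<in> typable \<longrightarrow> N \<in> typable \<longrightarrow> Ps \<in> lists typable \<longrightarrow> N \<in> B \<longrightarrow>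
        apps (App (lam x M) N) Ps \<in> typable \<longrightarrow> apps (subst M x N) Ps \<in> B \<longrightarrow>
        apps (App (lam x M) N) Ps \<in> B) \<and>
     (\<forall>a M Ns. M \<in> typable \<longrightarrow> Ns \<in> lists B \<longrightarrow> (\<forall>N\<in>set Ns. a \<notin> free_mvars N) \<longrightarrow>
        apps (mu a M) Ns \<in> typable \<longrightarrow> mu a (msubsts_r M a Ns) \<in> B \<longrightarrow>
        apps (mu a M) Ns \<in> B)"


lemma up_simps [simp]: "up f 0 = 0" "up f (Suc i) = Suc (f i)"
  by (simp_all add: up_def)

lemma inj_up: "inj g \<Longrightarrow> inj (up g)"
  by (rule injI) (auto simp: up_def inj_eq split: nat.splits)

lemma up_id [simp]: "up id = id"
  by (auto simp: up_def fun_eq_iff split: nat.split)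

lemma up_comp: "up f \<circ> up f' = up (f \<circ> f')"
  by (auto simp: up_def fun_eq_iff split: nat.split)

lemma ren_ren: "ren f g (ren f' g' M) = ren (f \<circ> f') (g \<circ> g') M"
  by (induction M arbitrary: f g f' g') (simp_all add: up_comp)

lemma ren_cong_mvars:
  "(\<And>a. a \<in> free_mvars M \<Longrightarrow> g a = g' a) \<Longrightarrow> ren f g M = ren f g' M"
proof (induction M arbitrary: f g g')
  case (Lam M)
  show ?case using Lam.IH[of g g'] Lam.prems by simp
next
  case (App M N)
  show ?case using App.IH(1)[of g g' f] App.IH(2)[of g g' f] App.prems by simp
next
  case (Nam a M)
  show ?case using Nam.IH[of g g' f] Nam.prems by simp
next
  case (Mu M)
  have "ren f (up g) M = ren f (up g') M"
    by (rule Mu.IH) (use Mu.prems in \<open>auto simp: up_def split: nat.split\<close>)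
  then show ?case by simp
qed simp

lemma sub_ren: "sub s (ren f id M) = sub (s \<circ> f) M"
proof (induction M arbitrary: s f)
  case (Lam M)
  have "case_nat (Var 0) (\<lambda>i. shift_var (s i)) \<circ> up f
      = case_nat (Var 0) (\<lambda>i. shift_var ((s \<circ> f) i))"
    by (auto simp: fun_eq_iff split: nat.split)
  then show ?case by (simp only: ren.simps sub.simps Lam.IH)
qed (simp_all add: comp_def)

lemma contr_Beta: "contr Beta (App (lam x M) N) (subst M x N)"
proof -
  have "case_nat N Var \<circ> abstr x = Var(x := N)"
    by (auto simp: abstr_def fun_eq_iff)
  then show ?thesis
    using contr.Beta[of "ren (abstr x) id M" N] by (simp add: lam_def subst_def sub_ren)
qed

lemma ren_msubst_r:
  "inj g \<Longrightarrow> ren f g (msubst_r M a N) = msubst_r (ren f g M) (g a) (ren f g N)"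
proof (induction M arbitrary: f g a N)
  case (Mu M)
  then have "inj (up g)" by (simp add: inj_up)
  then show ?case by (simp add: Mu.IH ren_ren comp_def)
qed (simp_all add: ren_ren comp_def inj_eq)

lemma ren_msubst_l:
  "inj g \<Longrightarrow> ren f g (msubst_l M a N) = msubst_l (ren f g M) (g a) (ren f g N)"
proof (induction M arbitrary: f g a N)
  case (Mu M)
  then have "inj (up g)" by (simp add: inj_up)
  then show ?case by (simp add: Mu.IH ren_ren comp_def)
qed (simp_all add: ren_ren comp_def inj_eq)

lemma ren_erase: "inj g \<Longrightarrow> ren f g (erase M a) = erase (ren f g M) (g a)"
proof (induction M arbitrary: f g a)
  case (Mu M)
  then have "inj (up g)" by (simp add: inj_up)
  then show ?case by (simp add: Mu.IH)
qed (simp_all add: inj_eq)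

lemma abstr_simps [simp]: "abstr a a = 0" "inj (abstr a)"
  by (auto simp: abstr_def inj_def)

lemma ren_abstr_fresh: "a \<notin> free_mvars N \<Longrightarrow> ren id (abstr a) N = shift_mvar N"
  by (rule ren_cong_mvars) (auto simp: abstr_def)

lemma contr_MuR:
  "a \<notin> free_mvars N \<Longrightarrow> contr MuR (App (mu a M) N) (mu a (msubst_r M a N))"
  by (simp add: mu_def ren_msubst_r ren_abstr_fresh contr.MuR)

lemma contr_MuL:
  "a \<notin> free_mvars N \<Longrightarrow> contr MuL (App N (mu a M)) (mu a (msubst_l M a N))"
  by (simp add: mu_def ren_msubst_l ren_abstr_fresh contr.MuL)

lemma contr_Rho: "contr Rho (Nam b (mu a M)) (rename_mvar M a b)"
proof -
  have "case_nat b id \<circ> abstr a = id(a := b)"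
    by (auto simp: abstr_def fun_eq_iff)
  then show ?thesis
    using contr.Rho[of b "ren id (abstr a) M"] by (simp add: mu_def rename_mvar_def ren_ren)
qed

lemma free_mvars_erase: "a \<notin> free_mvars (erase M a)"
  by (induction M arbitrary: a) auto

lemma contr_Epsilon: "contr Epsilon (mu a (mu b M)) (mu a (erase M b))"
proof -
  let ?g = "up (abstr a) \<circ> abstr b"
  have inj: "inj ?g"
    by (intro inj_compose inj_up abstr_simps)
  have "ren id (case_nat 0 id) (erase (ren id ?g M) 0)
      = ren id (case_nat 0 id) (ren id ?g (erase M b))"
    using ren_erase[OF inj, of id M b] by simp
  also have "\<dots> = ren id (case_nat 0 id \<circ> ?g) (erase M b)"
    by (simp add: ren_ren)
  also have "\<dots> = ren id (abstr a) (erase M b)"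
    by (rule ren_cong_mvars) (use free_mvars_erase in \<open>auto simp: abstr_def\<close>)
  finally show ?thesis
    using contr.Epsilon[of "ren id ?g M"] by (simp add: mu_def ren_ren)
qed

lemma typing_ren:
  assumes "typing \<Gamma> M A \<Theta>"
    and "\<And>x B. \<Gamma> x = Some B \<Longrightarrow> \<Gamma>' (f x) = Some B"
    and "\<And>a B. \<Theta> a = Some B \<Longrightarrow> \<Theta>' (g a) = Some B"
  shows "typing \<Gamma>' (ren f g M) A \<Theta>'"
  using assms
proof (induction arbitrary: f g \<Gamma>' \<Theta>')
  case (ty_Lam A \<Gamma> M B \<Theta>)
  have "typing (case_nat (Some A) \<Gamma>') (ren (up f) g M) B \<Theta>'"
    by (rule ty_Lam.IH) (use ty_Lam.prems in \<open>auto simp: up_def split: nat.splits\<close>)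
  then show ?case by (simp add: typing.ty_Lam)
next
  case (ty_Mu \<Gamma> M A \<Theta>)
  have "typing \<Gamma>' (ren f (up g) M) Bot (case_nat (Some A) \<Theta>')"
    by (rule ty_Mu.IH) (use ty_Mu.prems in \<open>auto simp: up_def split: nat.splits\<close>)
  then show ?case by (simp add: typing.ty_Mu)
next
  case (ty_App \<Gamma> M A B \<Theta> N)
  have "typing \<Gamma>' (ren f g M) (Arr A B) \<Theta>'" "typing \<Gamma>' (ren f g N) A \<Theta>'"
    by (rule ty_App.IH; simp add: ty_App.prems)+
  then show ?case by (simp add: typing.ty_App)
next
  case (ty_Nam \<Gamma> M A \<Theta> a)
  have "typing \<Gamma>' (ren f g M) A \<Theta>'"
    by (rule ty_Nam.IH; simp add: ty_Nam.prems)
  then show ?case using ty_Nam.prems(2)[OF ty_Nam.hyps(2)] by (simp add: typing.ty_Nam)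
qed (simp add: typing.ty_Var)

lemma typing_lam: "typing (\<Gamma>(x \<mapsto> A)) M B \<Theta> \<Longrightarrow> typing \<Gamma> (lam x M) (Arr A B) \<Theta>"
  unfolding lam_def
  by (rule typing.ty_Lam, erule typing_ren) (auto simp: abstr_def split: if_splits)

lemma typing_mu: "typing \<Gamma> M Bot (\<Theta>(a \<mapsto> A)) \<Longrightarrow> typing \<Gamma> (mu a M) A \<Theta>"
  unfolding mu_def
  by (rule typing.ty_Mu, erule typing_ren) (auto simp: abstr_def split: if_splits)

end

theory Submission
  imports Defs
begin

text \<open>
  The conditions on \<open>\<lambda>\<close>-abstractions, \<open>\<beta>\<close>-redexes and \<open>\<mu>\<close>-redexes hold because weak normalization is
  closed under injective renaming and under expansion.

  If \<open>\<mu>\<alpha>.M\<close> is typable and \<open>M\<close> has normal form \<open>\<mu>\<beta>.P\<close>, then \<open>\<beta>\<close> and the \<open>Q\<close> in each \<open>[\<beta>]Q\<close> have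
  type \<open>\<bottom>\<close>. Such a \<open>Q\<close> is no abstraction by typing and no \<open>\<mu>\<close>-term by \<open>\<rho>\<close>-normality, so
  \<open>\<mu>\<alpha>.P\<^sub>\<beta>\<close> is normal.

  For \<open>(x)N\<^sub>1\<dots>N\<^sub>n\<close> one normalizes from left to right, keeping as an invariant that the normal form is
  either a variable applied to arguments, or \<open>\<mu>\<alpha>.V\<close> where \<open>W\<close> is a variable applied to arguments for
  every \<open>[\<alpha>]W\<close> in \<open>V\<close>. Applying the latter to a normal \<open>\<mu>\<beta>.R\<close> turns \<open>[\<alpha>]W\<close> into \<open>[\<alpha>](W)\<mu>\<beta>.R\<close>, which by
  \<open>\<mu>'\<close> and \<open>\<rho>\<close> reduces to \<open>R[\<beta>:=\<^sub>lW][\<beta>:=\<alpha>]\<close>. This is normal, and it creates no redex in its context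
  because \<open>R\<close>, having type \<open>\<bottom>\<close>, is no abstraction.
\<close>

section \<open>Subject reduction\<close>

lemma typing_sub:
  assumes "typing \<Gamma> M A \<Theta>"
    and "\<And>x B. \<Gamma> x = Some B \<Longrightarrow> typing \<Gamma>' (s x) B \<Theta>"
  shows "typing \<Gamma>' (sub s M) A \<Theta>"
  using assms
proof (induction arbitrary: s \<Gamma>')
  case (ty_Lam A \<Gamma> M B \<Theta>)
  have "typing (case_nat (Some A) \<Gamma>') (sub (case_nat (Var 0) (\<lambda>i. shift_var (s i))) M) B \<Theta>"
  proof (rule ty_Lam.IH)
    fix x C
    assume "case_nat (Some A) \<Gamma> x = Some C"
    then show "typing (case_nat (Some A) \<Gamma>') (case_nat (Var 0) (\<lambda>i. shift_var (s i)) x) C \<Theta>"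
      by (cases x) (auto intro: typing.ty_Var typing_ren ty_Lam.prems)
  qed
  then show ?case by (simp add: typing.ty_Lam)
next
  case (ty_Mu \<Gamma> M A \<Theta>)
  have "typing \<Gamma>' (sub (\<lambda>i. shift_mvar (s i)) M) Bot (case_nat (Some A) \<Theta>)"
    by (rule ty_Mu.IH) (auto intro: typing_ren ty_Mu.prems)
  then show ?case by (simp add: typing.ty_Mu)
next
  case (ty_App \<Gamma> M A B \<Theta> N)
  have "typing \<Gamma>' (sub s M) (Arr A B) \<Theta>" "typing \<Gamma>' (sub s N) A \<Theta>"
    by (rule ty_App.IH; simp add: ty_App.prems)+
  then show ?case by (simp add: typing.ty_App)
next
  case (ty_Nam \<Gamma> M A \<Theta> a)
  have "typing \<Gamma>' (sub s M) A \<Theta>"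
    by (rule ty_Nam.IH; simp add: ty_Nam.prems)
  then show ?case using ty_Nam.hyps(2) by (simp add: typing.ty_Nam)
qed simp

lemma case_nat_upd: "case_nat u (h(a := v)) = (case_nat u h)(Suc a := v)"
  by (auto simp: fun_eq_iff split: nat.split)

lemma typing_shift_var: "typing \<Gamma> M A \<Theta> \<Longrightarrow> typing (case_nat u \<Gamma>) (shift_var M) A \<Theta>"
  by (erule typing_ren) auto

lemma typing_shift_mvar: "typing \<Gamma> M A \<Theta> \<Longrightarrow> typing \<Gamma> (shift_mvar M) A (case_nat u \<Theta>)"
  by (erule typing_ren) auto

text \<open>Each \<open>[a]P\<close> becomes \<open>[a](P')N\<close>, which lowers the type of
  \<open>a\<close> from \<open>Arr A B\<close> to \<open>B\<close>. The inserted copies of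
  \<open>N\<close> are not substituted into, so \<open>N\<close> is typed under the new declaration
  of \<open>a\<close>.\<close>

lemma typing_msubst_r:
  assumes "typing \<Gamma> M C \<Theta>" and "\<Theta> a = Some (Arr A B)" and "typing \<Gamma> N A (\<Theta>(a \<mapsto> B))"
  shows "typing \<Gamma> (msubst_r M a N) C (\<Theta>(a \<mapsto> B))"
  using assms
proof (induction arbitrary: a N)
  case (ty_Lam D \<Gamma> M E \<Theta>)
  have "typing (case_nat (Some D) \<Gamma>) (msubst_r M a (shift_var N)) E (\<Theta>(a \<mapsto> B))"
    by (rule ty_Lam.IH[OF ty_Lam.prems(1) typing_shift_var[OF ty_Lam.prems(2)]])
  then show ?case by (simp only: msubst_r.simps typing.ty_Lam)
next
  case (ty_Mu \<Gamma> M D \<Theta>)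
  have "typing \<Gamma> (msubst_r M (Suc a) (shift_mvar N)) Bot ((case_nat (Some D) \<Theta>)(Suc a \<mapsto> B))"
    by (rule ty_Mu.IH, simp add: ty_Mu.prems(1), subst case_nat_upd [symmetric])
      (rule typing_shift_mvar[OF ty_Mu.prems(2)])
  then show ?case
    by (simp only: case_nat_upd [symmetric] msubst_r.simps msubst_l.simps erase.simps typing.ty_Mu)
next
  case (ty_Nam \<Gamma> M D \<Theta> b)
  note IH = ty_Nam.IH[OF ty_Nam.prems]
  show ?case
  proof (cases "b = a")
    case True
    then have "typing \<Gamma> (App (msubst_r M a N) N) B (\<Theta>(a \<mapsto> B))"
      using IH ty_Nam.hyps(2) ty_Nam.prems by (metis option.inject typing.ty_App)
    then show ?thesis
      unfolding msubst_r.simps if_P[OF True] by (rule typing.ty_Nam) simp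
  next
    case False
    show ?thesis
      unfolding msubst_r.simps if_not_P[OF False] using IH
      by (rule typing.ty_Nam) (simp add: False ty_Nam.hyps(2))
  qed
next
  case (ty_App \<Gamma> M D E \<Theta> P)
  show ?case
    using ty_App.IH[OF ty_App.prems] by (auto intro: typing.ty_App)
qed (simp add: typing.ty_Var)

text \<open>Here \<open>a\<close> passes from the argument type to the result type of the function
  \<open>N\<close> put in front of each \<open>P'\<close>.\<close>

lemma typing_msubst_l:
  assumes "typing \<Gamma> M C \<Theta>" and "\<Theta> a = Some A" and "typing \<Gamma> N (Arr A B) (\<Theta>(a \<mapsto> B))"
  shows "typing \<Gamma> (msubst_l M a N) C (\<Theta>(a \<mapsto> B))"
  using assms
proof (induction arbitrary: a N)
  case (ty_Lam D \<Gamma> M E \<Theta>)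
  have "typing (case_nat (Some D) \<Gamma>) (msubst_l M a (shift_var N)) E (\<Theta>(a \<mapsto> B))"
    by (rule ty_Lam.IH[OF ty_Lam.prems(1) typing_shift_var[OF ty_Lam.prems(2)]])
  then show ?case by (simp only: msubst_l.simps typing.ty_Lam)
next
  case (ty_Mu \<Gamma> M D \<Theta>)
  have "typing \<Gamma> (msubst_l M (Suc a) (shift_mvar N)) Bot ((case_nat (Some D) \<Theta>)(Suc a \<mapsto> B))"
    by (rule ty_Mu.IH, simp add: ty_Mu.prems(1), subst case_nat_upd [symmetric])
      (rule typing_shift_mvar[OF ty_Mu.prems(2)])
  then show ?case
    by (simp only: case_nat_upd [symmetric] msubst_r.simps msubst_l.simps erase.simps typing.ty_Mu)
next
  case (ty_Nam \<Gamma> M D \<Theta> b)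
  note IH = ty_Nam.IH[OF ty_Nam.prems]
  show ?case
  proof (cases "b = a")
    case True
    then have "typing \<Gamma> (App N (msubst_l M a N)) B (\<Theta>(a \<mapsto> B))"
      using IH ty_Nam.hyps(2) ty_Nam.prems by (metis option.inject typing.ty_App)
    then show ?thesis
      unfolding msubst_l.simps if_P[OF True] by (rule typing.ty_Nam) simp
  next
    case False
    show ?thesis
      unfolding msubst_l.simps if_not_P[OF False] using IH
      by (rule typing.ty_Nam) (simp add: False ty_Nam.hyps(2))
  qed
next
  case (ty_App \<Gamma> M D E \<Theta> P)
  show ?case
    using ty_App.IH[OF ty_App.prems] by (auto intro: typing.ty_App)
qed (simp add: typing.ty_Var)

text \<open>The declaration \<open>u\<close> of \<open>a\<close> in the conclusion is arbitrary because \<open>a\<close> no longer occurs.\<close>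

lemma typing_erase:
  assumes "typing \<Gamma> M A \<Theta>" and "\<Theta> a = Some Bot"
  shows "typing \<Gamma> (erase M a) A (\<Theta>(a := u))"
  using assms
proof (induction arbitrary: a)
  case (ty_Mu \<Gamma> M D \<Theta>)
  have "typing \<Gamma> (erase M (Suc a)) Bot ((case_nat (Some D) \<Theta>)(Suc a := u))"
    by (rule ty_Mu.IH) (use ty_Mu.prems in simp)
  then show ?case
    by (simp only: case_nat_upd [symmetric] msubst_r.simps msubst_l.simps erase.simps typing.ty_Mu)
next
  case (ty_Nam \<Gamma> M D \<Theta> b)
  note IH = ty_Nam.IH[OF ty_Nam.prems]
  show ?case
  proof (cases "b = a")
    case True
    then have "D = Bot" using ty_Nam.hyps(2) ty_Nam.prems by simp
    then show ?thesis
      unfolding erase.simps if_P[OF True] using IH by (simp only:)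
  next
    case False
    show ?thesis
      unfolding erase.simps if_not_P[OF False] using IH
      by (rule typing.ty_Nam) (simp add: False ty_Nam.hyps(2))
  qed
qed (auto intro: typing.intros)

inductive_cases typing_LamE: "typing \<Gamma> (Lam M) A \<Theta>"
inductive_cases typing_AppE: "typing \<Gamma> (App M N) A \<Theta>"
inductive_cases typing_NamE: "typing \<Gamma> (Nam a M) A \<Theta>"
inductive_cases typing_MuE: "typing \<Gamma> (Mu M) A \<Theta>"

lemma case_nat_upd_0: "(case_nat u h)(0 := v) = case_nat v h"
  by (auto simp: fun_eq_iff split: nat.split)

lemma contr_typing:
  assumes "contr r M M'" and "typing \<Gamma> M A \<Theta>"
  shows "typing \<Gamma> M' A \<Theta>"
  using assms
proof cases
  case (Beta M N)
  then obtain B where "typing (case_nat (Some B) \<Gamma>) M A \<Theta>" "typing \<Gamma> N B \<Theta>"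
    using assms(2) by (auto elim!: typing_AppE typing_LamE)
  then show ?thesis
    unfolding Beta by (auto elim!: typing_sub intro: typing.ty_Var split: nat.splits)
next
  case (MuR M N)
  then obtain B where M: "typing \<Gamma> M Bot (case_nat (Some (Arr B A)) \<Theta>)" and N: "typing \<Gamma> N B \<Theta>"
    using assms(2) by (auto elim!: typing_AppE typing_MuE)
  have "typing \<Gamma> (msubst_r M 0 (shift_mvar N)) Bot ((case_nat (Some (Arr B A)) \<Theta>)(0 \<mapsto> A))"
    by (rule typing_msubst_r[OF M, where A = B], simp, subst case_nat_upd_0)
      (rule typing_shift_mvar[OF N])
  then show ?thesis unfolding MuR by (simp add: case_nat_upd_0 typing.ty_Mu)
next
  case (MuL N M)
  then obtain B where M: "typing \<Gamma> M Bot (case_nat (Some B) \<Theta>)" and N: "typing \<Gamma> N (Arr B A) \<Theta>"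
    using assms(2) by (auto elim!: typing_AppE typing_MuE)
  have "typing \<Gamma> (msubst_l M 0 (shift_mvar N)) Bot ((case_nat (Some B) \<Theta>)(0 \<mapsto> A))"
    by (rule typing_msubst_l[OF M, where A = B], simp, subst case_nat_upd_0)
      (rule typing_shift_mvar[OF N])
  then show ?thesis unfolding MuL by (simp add: case_nat_upd_0 typing.ty_Mu)
next
  case (Rho b M)
  then obtain B where "typing \<Gamma> M Bot (case_nat (Some B) \<Theta>)" "\<Theta> b = Some B" "A = Bot"
    using assms(2) by (auto elim!: typing_NamE typing_MuE)
  then show ?thesis
    unfolding Rho by (auto elim!: typing_ren split: nat.splits)
next
  case (Epsilon M)
  then have "typing \<Gamma> M Bot (case_nat (Some Bot) (case_nat (Some A) \<Theta>))"
    using assms(2) by (auto elim!: typing_MuE)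
  \<comment> \<open>Undeclaring index 0 makes the typing condition on the renaming
    \<open>case_nat 0 id\<close> vacuous at 0, which it would otherwise send from type \<bottom> to
    type \<open>A\<close>.\<close>
  then have "typing \<Gamma> (erase M 0) Bot (case_nat None (case_nat (Some A) \<Theta>))"
    by (subst case_nat_upd_0 [symmetric]) (rule typing_erase, simp_all)
  then have "typing \<Gamma> (ren id (case_nat 0 id) (erase M 0)) Bot (case_nat (Some A) \<Theta>)"
    by (rule typing_ren) (auto split: nat.splits)
  then show ?thesis unfolding Epsilon by (rule typing.ty_Mu)
qed

lemma step_typing:
  assumes "step R M M'" and "typing \<Gamma> M A \<Theta>"
  shows "typing \<Gamma> M' A \<Theta>"
  using assms
proof (induction arbitrary: \<Gamma> A \<Theta>)
  case (root r M N)
  then show ?case by (blast intro: contr_typing)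
next
  case (Lam M N)
  from Lam.prems show ?case by (rule typing_LamE) (auto intro: typing.ty_Lam Lam.IH)
next
  case (AppL M N P)
  from AppL.prems show ?case by (rule typing_AppE) (auto intro: typing.ty_App AppL.IH)
next
  case (AppR M N P)
  from AppR.prems show ?case by (rule typing_AppE) (auto intro: typing.ty_App AppR.IH)
next
  case (Nam M N a)
  from Nam.prems show ?case by (rule typing_NamE) (auto intro: typing.ty_Nam Nam.IH)
next
  case (Mu M N)
  from Mu.prems show ?case by (rule typing_MuE) (auto intro: typing.ty_Mu Mu.IH)
qed

lemma steps_typing:
  "(step R)\<^sup>*\<^sup>* M M' \<Longrightarrow> typing \<Gamma> M A \<Theta> \<Longrightarrow> typing \<Gamma> M' A \<Theta>"
  by (induction rule: rtranclp_induct) (auto intro: step_typing)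

section \<open>Reduction under contexts and renamings\<close>

lemma steps_Lam: "(step R)\<^sup>*\<^sup>* M N \<Longrightarrow> (step R)\<^sup>*\<^sup>* (Lam M) (Lam N)"
  by (induction rule: rtranclp_induct) (auto intro: step.Lam rtranclp.rtrancl_into_rtrancl)

lemma steps_Nam: "(step R)\<^sup>*\<^sup>* M N \<Longrightarrow> (step R)\<^sup>*\<^sup>* (Nam a M) (Nam a N)"
  by (induction rule: rtranclp_induct) (auto intro: step.Nam rtranclp.rtrancl_into_rtrancl)

lemma steps_Mu: "(step R)\<^sup>*\<^sup>* M N \<Longrightarrow> (step R)\<^sup>*\<^sup>* (Mu M) (Mu N)"
  by (induction rule: rtranclp_induct) (auto intro: step.Mu rtranclp.rtrancl_into_rtrancl)

lemma steps_AppL: "(step R)\<^sup>*\<^sup>* M N \<Longrightarrow> (step R)\<^sup>*\<^sup>* (App M P) (App N P)"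
  by (induction rule: rtranclp_induct) (auto intro: step.AppL rtranclp.rtrancl_into_rtrancl)

lemma steps_AppR: "(step R)\<^sup>*\<^sup>* M N \<Longrightarrow> (step R)\<^sup>*\<^sup>* (App P M) (App P N)"
  by (induction rule: rtranclp_induct) (auto intro: step.AppR rtranclp.rtrancl_into_rtrancl)

lemma steps_App:
  "(step R)\<^sup>*\<^sup>* M M' \<Longrightarrow> (step R)\<^sup>*\<^sup>* N N' \<Longrightarrow> (step R)\<^sup>*\<^sup>* (App M N) (App M' N')"
  by (meson rtranclp_trans steps_AppL steps_AppR)

lemma apps_simps [simp]:
  "apps M [] = M" "apps M (N # Ns) = apps (App M N) Ns" "apps M (Ns @ [N]) = App (apps M Ns) N"
  by (simp_all add: apps_def)

lemma step_apps: "step R M N \<Longrightarrow> step R (apps M Ps) (apps N Ps)"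
  by (induction Ps rule: rev_induct) (auto intro: step.AppL)

text \<open>Variables of \<open>M\<close> and variables of the substituted terms are renamed
  separately, by \<open>f'\<close> and by \<open>f\<close>: contracting a \<beta>-redex removes a
  binder, so there \<open>f'\<close> is \<open>up f\<close>.\<close>

lemma ren_sub:
  "(\<And>i. ren f g (s i) = s' (f' i)) \<Longrightarrow> ren f g (sub s M) = sub s' (ren f' g M)"
proof (induction M arbitrary: f g s s' f')
  case (Lam M)
  have "ren (up f) g (sub (case_nat (Var 0) (\<lambda>i. shift_var (s i))) M)
      = sub (case_nat (Var 0) (\<lambda>i. shift_var (s' i))) (ren (up f') g M)"
  proof (rule Lam.IH)
    fix i
    show "ren (up f) g (case_nat (Var 0) (\<lambda>i. shift_var (s i)) i)
        = case_nat (Var 0) (\<lambda>i. shift_var (s' i)) (up f' i)"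
      by (cases i) (simp_all add: ren_ren comp_def flip: Lam.prems)
  qed
  then show ?case by simp
next
  case (Mu M)
  have "ren f (up g) (sub (\<lambda>i. shift_mvar (s i)) M)
      = sub (\<lambda>i. shift_mvar (s' i)) (ren f' (up g) M)"
    by (rule Mu.IH) (simp add: ren_ren comp_def flip: Mu.prems)
  then show ?case by simp
next
  case (App M N)
  have "ren f g (sub s M) = sub s' (ren f' g M)" "ren f g (sub s N) = sub s' (ren f' g N)"
    by (rule App.IH; rule App.prems)+
  then show ?case by simp
next
  case (Nam a M)
  have "ren f g (sub s M) = sub s' (ren f' g M)"
    by (rule Nam.IH; rule Nam.prems)
  then show ?case by simp
qed simp

lemma contr_ren:
  assumes "contr r M N" and "inj g"
  shows "contr r (ren f g M) (ren f g N)"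
  using assms(1)
proof cases
  case (Beta M N)
  have "ren f g (sub (case_nat N Var) M) = sub (case_nat (ren f g N) Var) (ren (up f) g M)"
    by (rule ren_sub) (auto split: nat.split simp: up_def)
  then show ?thesis unfolding Beta by (simp add: contr.Beta)
next
  case (MuR M N)
  have "ren f (up g) (shift_mvar N) = shift_mvar (ren f g N)"
    by (simp add: ren_ren comp_def)
  then show ?thesis unfolding MuR
    using contr.MuR by (simp add: ren_msubst_r inj_up assms(2))
next
  case (MuL N M)
  have "ren f (up g) (shift_mvar N) = shift_mvar (ren f g N)"
    by (simp add: ren_ren comp_def)
  then show ?thesis unfolding MuL
    using contr.MuL by (simp add: ren_msubst_l inj_up assms(2))
next
  case (Rho b M)
  have "g \<circ> case_nat b id = case_nat (g b) id \<circ> up g"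
    by (auto simp: fun_eq_iff up_def split: nat.split)
  then have "ren f g (ren id (case_nat b id) M) = ren id (case_nat (g b) id) (ren f (up g) M)"
    by (simp add: ren_ren)
  then show ?thesis unfolding Rho by (simp add: contr.Rho)
next
  case (Epsilon M)
  have "up g \<circ> case_nat 0 id = case_nat 0 id \<circ> up (up g)"
    by (auto simp: fun_eq_iff up_def split: nat.split)
  then have "ren f (up g) (ren id (case_nat 0 id) (erase M 0))
      = ren id (case_nat 0 id) (ren f (up (up g)) (erase M 0))"
    by (simp add: ren_ren)
  also have "\<dots> = ren id (case_nat 0 id) (erase (ren f (up (up g)) M) 0)"
    by (simp add: ren_erase inj_up assms(2))
  finally show ?thesis unfolding Epsilon by (simp add: contr.Epsilon)
qed

text \<open>Lets reductions pass under \<open>lam x\<close> and \<open>mu a\<close>, which rename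
  the body by \<open>abstr\<close> before binding.\<close>

lemma step_ren:
  "step R M N \<Longrightarrow> inj g \<Longrightarrow> step R (ren f g M) (ren f g N)"
  by (induction arbitrary: f g rule: step.induct)
    (auto intro: step.intros contr_ren inj_up)

lemma steps_ren:
  "(step R)\<^sup>*\<^sup>* M N \<Longrightarrow> inj g \<Longrightarrow> (step R)\<^sup>*\<^sup>* (ren f g M) (ren f g N)"
  by (induction rule: rtranclp_induct)
    (auto intro: step_ren rtranclp.rtrancl_into_rtrancl)

section \<open>Normal forms\<close>

fun is_lam :: "trm \<Rightarrow> bool" where
  "is_lam (Lam M) = True"
| "is_lam _ = False"

fun is_mu :: "trm \<Rightarrow> bool" where
  "is_mu (Mu M) = True"
| "is_mu _ = False"

primrec neutral :: "trm \<Rightarrow> bool" where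
  "neutral (Var x) = True"
| "neutral (Lam M) = False"
| "neutral (App M N) = neutral M"
| "neutral (Nam a M) = False"
| "neutral (Mu M) = False"

text \<open>Normality for all five rules, read off the shapes of immediate subterms: the side
  conditions exclude \<beta>, \<mu> and \<mu>' at applications, \<rho> at names and \<epsilon> at
  \<mu>-abstractions.\<close>

primrec nf :: "trm \<Rightarrow> bool" where
  "nf (Var x) = True"
| "nf (Lam M) = nf M"
| "nf (App M N) = (nf M \<and> nf N \<and> \<not> is_lam M \<and> \<not> is_mu M \<and> \<not> is_mu N)"
| "nf (Nam a M) = (nf M \<and> \<not> is_mu M)"
| "nf (Mu M) = (nf M \<and> \<not> is_mu M)"

lemma is_lam_iff: "is_lam M \<longleftrightarrow> (\<exists>P. M = Lam P)"
  by (cases M) auto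

lemma is_mu_iff: "is_mu M \<longleftrightarrow> (\<exists>P. M = Mu P)"
  by (cases M) auto

lemma nf_not_step: "step R M N \<Longrightarrow> \<not> nf M"
  by (induction rule: step.induct) (auto elim: contr.cases)

lemma not_nf_step: "\<not> nf M \<Longrightarrow> \<exists>N. step UNIV M N"
proof (induction M)
  case (App M N)
  then show ?case
    by (auto simp: is_lam_iff is_mu_iff
        intro: step.AppL step.AppR step.root[OF UNIV_I contr.Beta]
          step.root[OF UNIV_I contr.MuR] step.root[OF UNIV_I contr.MuL])
next
  case (Nam a M)
  then show ?case
    by (auto simp: is_mu_iff intro: step.Nam step.root[OF UNIV_I contr.Rho])
next
  case (Mu M)
  then show ?case
    by (auto simp: is_mu_iff intro: step.Mu step.root[OF UNIV_I contr.Epsilon])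
qed (auto intro: step.Lam)

lemma normal_iff_nf: "normal UNIV M \<longleftrightarrow> nf M"
  unfolding normal_def using nf_not_step not_nf_step by blast

lemma WN_iff: "M \<in> WN UNIV \<longleftrightarrow> (\<exists>N. (step UNIV)\<^sup>*\<^sup>* M N \<and> nf N)"
  by (simp add: WN_def normal_iff_nf)

lemma WN_expand: "(step R)\<^sup>*\<^sup>* M N \<Longrightarrow> N \<in> WN R \<Longrightarrow> M \<in> WN R"
  unfolding WN_def by (blast intro: rtranclp_trans)

lemma ren_shape [simp]:
  "is_lam (ren f g M) = is_lam M" "is_mu (ren f g M) = is_mu M" "neutral (ren f g M) = neutral M"
  by (induction M arbitrary: f g) auto

lemma nf_ren [simp]: "nf (ren f g M) = nf M"
  by (induction M arbitrary: f g) auto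

lemma msubst_l_shape [simp]:
  "is_lam (msubst_l M a N) = is_lam M" "is_mu (msubst_l M a N) = is_mu M"
  by (cases M; simp)+

lemma neutral_msubst_l [simp]: "neutral (msubst_l M a N) = neutral M"
  by (induction M) auto

lemma neutral_shape: "neutral M \<Longrightarrow> \<not> is_lam M \<and> \<not> is_mu M"
  by (cases M) auto

text \<open>In the new \<open>[a](N)P'\<close> the head \<open>N\<close> is neutral, hence no
  abstraction and no \<mu>-term, and \<open>P'\<close> has the shape of \<open>P\<close>, which is
  no \<mu>-term because \<open>[a]P\<close> was \<rho>-normal.\<close>

lemma nf_msubst_l: "nf M \<Longrightarrow> nf N \<Longrightarrow> neutral N \<Longrightarrow> nf (msubst_l M a N)"
  by (induction M arbitrary: a N) (auto simp: neutral_shape)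

text \<open>A subterm exposed by deleting \<open>[a]\<close> is no \<mu>-term by \<rho>-normality
  and no abstraction because its type is \<bottom>. The two implications on shapes carry this
  through the induction: the context meets no new abstraction or \<mu>-term.\<close>

lemma nf_erase:
  assumes "typing \<Gamma> M A \<Theta>" and "\<Theta> a = Some Bot" and "nf M"
  shows "nf (erase M a) \<and> (is_lam (erase M a) \<longrightarrow> is_lam M) \<and> (is_mu (erase M a) \<longrightarrow> is_mu M)"
  using assms
proof (induction arbitrary: a)
  case (ty_Nam \<Gamma> M A \<Theta> b)
  have "\<not> is_lam M" if "A = Bot"
    using ty_Nam.hyps(1) that by (auto simp: is_lam_iff elim: typing_LamE)
  then show ?case using ty_Nam by auto
qed auto

section \<open>Applications of a variable to normal terms\<close>

text \<open>The invariant on the body of a \<mu>-term about to receive an argument: turning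
  \<open>[a]W\<close> into \<open>[a](W)N\<close> then creates neither a \<beta>- nor a \<mu>-redex,
  since \<open>W\<close> is neutral.\<close>

primrec good :: "nat \<Rightarrow> trm \<Rightarrow> bool" where
  "good a (Var x) = True"
| "good a (Lam M) = good a M"
| "good a (App M N) = (good a M \<and> good a N)"
| "good a (Nam b M) = (good a M \<and> (b = a \<longrightarrow> neutral M))"
| "good a (Mu M) = good (Suc a) M"

lemma up_eq_Suc: "up g b = Suc c \<longleftrightarrow> (\<exists>d. b = Suc d \<and> g d = c)"
  by (auto simp: up_def split: nat.split)

text \<open>All preimages of \<open>c\<close> count because \<rho> may merge names:
  \<open>case_nat a id\<close> sends both \<open>0\<close> and \<open>Suc a\<close> to
  \<open>a\<close>.\<close>

lemma good_ren: "good c (ren f g M) \<longleftrightarrow> (\<forall>b. g b = c \<longrightarrow> good b M)"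
  by (induction M arbitrary: f g c) (auto simp: up_eq_Suc)

text \<open>For \<open>c = a\<close> goodness is created: every \<open>[a]P\<close> becomes
  \<open>[a](N)P'\<close>, whose body has the neutral head \<open>N\<close>. For other names it is
  inherited, as the substitution preserves neutrality.\<close>

lemma good_msubst_l:
  "good c M \<or> c = a \<Longrightarrow> good c N \<Longrightarrow> neutral N \<Longrightarrow> good c (msubst_l M a N)"
  by (induction M arbitrary: a c N) (auto simp: good_ren)

text \<open>What normalization needs from the typing of an argument: the body of a \<mu>-term has
  type \<bottom>, so it is no abstraction. In this syntactic form no types have to be carried
  through the inductions.\<close>

definition mu_body_ok :: "trm \<Rightarrow> bool" where
  "mu_body_ok N \<longleftrightarrow> (\<forall>R. N = Mu R \<longrightarrow> \<not> is_lam R)"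

lemma mu_body_ok_ren [simp]: "mu_body_ok (ren f g N) = mu_body_ok N"
  by (cases N) (simp_all add: mu_body_ok_def)

lemma typing_mu_body_ok: "typing \<Gamma> N A \<Theta> \<Longrightarrow> mu_body_ok N"
  by (auto simp: mu_body_ok_def is_lam_iff elim!: typing_MuE typing_LamE)

text \<open>Induction on \<open>V\<close>, treating \<open>[a](W)N\<close> once \<open>W\<close> is
  normalized. The clauses on \<open>is_lam\<close> and \<open>is_mu\<close> keep the context from
  gaining a redex; the clause on \<open>neutral\<close> makes the normal form of \<open>W\<close> a
  head that can safely be applied to \<open>N\<close>.\<close>

lemma msubst_r_normalizes:
  assumes "nf V" and "good a V" and "nf N" and "good a N" and "mu_body_ok N"
  shows "\<exists>V'. (step UNIV)\<^sup>*\<^sup>* (msubst_r V a N) V' \<and> nf V' \<and> good a V' \<and>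
    (is_lam V' \<longrightarrow> is_lam V) \<and> (is_mu V' \<longrightarrow> is_mu V) \<and> (neutral V \<longrightarrow> neutral V')"
  using assms
proof (induction V arbitrary: a N)
  case (Var x)
  show ?case by (intro exI[of _ "Var x"]) simp
next
  case (Lam V)
  obtain V' where "(step UNIV)\<^sup>*\<^sup>* (msubst_r V a (shift_var N)) V'" "nf V'" "good a V'"
    using Lam.IH[of a "shift_var N"] Lam.prems by (auto simp: good_ren)
  then show ?case by (intro exI[of _ "Lam V'"]) (simp add: steps_Lam)
next
  case (App V W)
  obtain V' where "(step UNIV)\<^sup>*\<^sup>* (msubst_r V a N) V'" "nf V'" "good a V'"
    "is_lam V' \<longrightarrow> is_lam V" "is_mu V' \<longrightarrow> is_mu V" "neutral V \<longrightarrow> neutral V'"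
    using App.IH(1)[of a N] App.prems by auto
  moreover obtain W' where "(step UNIV)\<^sup>*\<^sup>* (msubst_r W a N) W'" "nf W'" "good a W'"
    "is_mu W' \<longrightarrow> is_mu W"
    using App.IH(2)[of a N] App.prems by auto
  ultimately show ?case
    using App.prems by (intro exI[of _ "App V' W'"]) (auto simp: steps_App)
next
  case (Nam b W)
  obtain W' where W': "(step UNIV)\<^sup>*\<^sup>* (msubst_r W a N) W'" "nf W'" "good a W'"
    "is_mu W' \<longrightarrow> is_mu W" "neutral W \<longrightarrow> neutral W'"
    using Nam.IH[of a N] Nam.prems by auto
  consider "b \<noteq> a" | "b = a" "\<not> is_mu N" | R where "b = a" "N = Mu R"
    by (auto simp: is_mu_iff)
  then show ?case
  proof cases
    case 1
    then show ?thesis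
      using W' Nam.prems by (intro exI[of _ "Nam b W'"]) (auto simp: steps_Nam)
  next
    case 2
    then show ?thesis
      using W' Nam.prems
      by (intro exI[of _ "Nam a (App W' N)"]) (auto simp: steps_Nam steps_AppL neutral_shape)
  next
    case 3
    \<comment> \<open>With \<open>N\<close> read as \<mu>\<beta>.R, this is
      \<open>R[\<beta>:=\<^sub>lW'][\<beta>:=a]\<close>: the \<mu>'-step leaves a \<mu>-term
      directly below \<open>[a]\<close>, and \<rho> removes it.\<close>
    let ?V = "ren id (case_nat a id) (msubst_l R 0 (shift_mvar W'))"
    have "neutral W'" using W' Nam.prems 3 by auto
    have "(step UNIV)\<^sup>*\<^sup>* (Nam a (App (msubst_r W a N) N)) (Nam a (App W' N))"
      using W' by (simp add: steps_Nam steps_AppL)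
    also have "step UNIV (Nam a (App W' N)) (Nam a (Mu (msubst_l R 0 (shift_mvar W'))))"
      unfolding 3 by (intro step.Nam step.root[OF UNIV_I contr.MuL])
    also have "step UNIV (Nam a (Mu (msubst_l R 0 (shift_mvar W')))) ?V"
      by (rule step.root[OF UNIV_I contr.Rho])
    finally have "(step UNIV)\<^sup>*\<^sup>* (msubst_r (Nam b W) a N) ?V"
      using 3 by simp
    \<comment> \<open>\<open>?V\<close> has the shape of \<open>R\<close>, which is no abstraction
      by \<open>mu_body_ok\<close> and no \<mu>-term by \<epsilon>-normality of
      \<open>N\<close>.\<close>
    moreover have "nf ?V" "\<not> is_lam ?V" "\<not> is_mu ?V"
      using Nam.prems 3 W' \<open>neutral W'\<close> by (auto simp: nf_msubst_l mu_body_ok_def)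
    \<comment> \<open>Of the two names merged into \<open>a\<close>, index 0 is good by the case
      \<open>c = a\<close> of \<open>good_msubst_l\<close>, and \<open>Suc a\<close> by goodness of
      \<open>N\<close> and \<open>W'\<close>.\<close>
    moreover have "good a ?V"
      using Nam.prems 3 W' \<open>neutral W'\<close>
      by (auto simp: good_ren intro!: good_msubst_l split: nat.splits)
    ultimately show ?thesis by auto
  qed
next
  case (Mu V)
  obtain V' where "(step UNIV)\<^sup>*\<^sup>* (msubst_r V (Suc a) (shift_mvar N)) V'" "nf V'"
    "good (Suc a) V'" "is_mu V' \<longrightarrow> is_mu V"
    using Mu.IH[of "Suc a" "shift_mvar N"] Mu.prems by (auto simp: good_ren)
  then show ?case
    using Mu.prems by (intro exI[of _ "Mu V'"]) (auto simp: steps_Mu)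
qed

lemma App_normalizes:
  assumes T: "nf T" "neutral T \<or> (\<exists>V. T = Mu V \<and> good 0 V)"
    and N: "nf N" "mu_body_ok N"
  shows "\<exists>T'. (step UNIV)\<^sup>*\<^sup>* (App T N) T' \<and> nf T' \<and>
    (neutral T' \<or> (\<exists>V. T' = Mu V \<and> good 0 V))"
proof -
  consider "neutral T" "\<not> is_mu N" | R where "neutral T" "N = Mu R"
    | V where "T = Mu V" "good 0 V"
    using T(2) by (auto simp: is_mu_iff)
  then show ?thesis
  proof cases
    case 1
    then show ?thesis
      using T N by (intro exI[of _ "App T N"]) (auto simp: neutral_shape)
  next
    case 2
    let ?V = "msubst_l R 0 (shift_mvar T)"
    have "step UNIV (App T N) (Mu ?V)"
      unfolding 2 by (rule step.root[OF UNIV_I contr.MuL])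
    moreover have "nf (Mu ?V)"
      using T N 2 by (auto simp: nf_msubst_l)
    moreover have "good 0 ?V"
      using 2 by (auto simp: good_ren intro!: good_msubst_l)
    ultimately show ?thesis by blast
  next
    case 3
    \<comment> \<open>If \<open>N\<close> is a \<mu>-term too, both \<mu> and \<mu>' apply; \<mu> is
      chosen, so that goodness of \<open>V\<close> can be used.\<close>
    have "step UNIV (App T N) (Mu (msubst_r V 0 (shift_mvar N)))"
      unfolding 3 by (rule step.root[OF UNIV_I contr.MuR])
    moreover obtain V' where V': "(step UNIV)\<^sup>*\<^sup>* (msubst_r V 0 (shift_mvar N)) V'" "nf V'"
      "good 0 V'" "is_mu V' \<longrightarrow> is_mu V"
      using msubst_r_normalizes[of V 0 "shift_mvar N"] T N 3 by (auto simp: good_ren)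
    ultimately have "(step UNIV)\<^sup>*\<^sup>* (App T N) (Mu V')"
      by (meson converse_rtranclp_into_rtranclp steps_Mu)
    moreover have "nf (Mu V')"
      using V' T 3 by auto
    ultimately show ?thesis using V' by blast
  qed
qed

lemma apps_Var_normalizes:
  assumes "set Ns \<subseteq> WN UNIV \<inter> typable"
  shows "\<exists>T. (step UNIV)\<^sup>*\<^sup>* (apps (Var x) Ns) T \<and> nf T \<and>
    (neutral T \<or> (\<exists>V. T = Mu V \<and> good 0 V))"
  using assms
proof (induction Ns rule: rev_induct)
  case Nil
  show ?case by (intro exI[of _ "Var x"]) simp
next
  case (snoc N Ns)
  obtain T where T: "(step UNIV)\<^sup>*\<^sup>* (apps (Var x) Ns) T" "nf T"
    "neutral T \<or> (\<exists>V. T = Mu V \<and> good 0 V)"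
    using snoc by auto
  obtain N' where N': "(step UNIV)\<^sup>*\<^sup>* N N'" "nf N'"
    using snoc.prems by (auto simp: WN_iff)
  \<comment> \<open>Subject reduction carries the type of \<open>N\<close> over to its normal
    form.\<close>
  have "mu_body_ok N'"
    using snoc.prems steps_typing[OF N'(1)] by (auto simp: typable_def intro: typing_mu_body_ok)
  then obtain T' where T': "(step UNIV)\<^sup>*\<^sup>* (App T N') T'" "nf T'"
    "neutral T' \<or> (\<exists>V. T' = Mu V \<and> good 0 V)"
    using App_normalizes[OF T(2,3) N'(2)] by blast
  have "(step UNIV)\<^sup>*\<^sup>* (apps (Var x) (Ns @ [N])) (App T N')"
    using T(1) N'(1) by (simp add: steps_App)
  then have "(step UNIV)\<^sup>*\<^sup>* (apps (Var x) (Ns @ [N])) T'"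
    using T'(1) by (rule rtranclp_trans)
  then show ?case using T'(2,3) by blast
qed

section \<open>Saturation\<close>

lemma lam_typable:
  assumes "M \<in> typable"
  shows "lam x M \<in> typable"
proof -
  obtain \<Gamma> A \<Theta> where fin: "finite (dom \<Gamma>)" "finite (dom \<Theta>)" and ty: "typing \<Gamma> M A \<Theta>"
    using assms by (auto simp: typable_def)
  \<comment> \<open>The domain type must agree with a declaration of \<open>x\<close> in \<Gamma>;
    if there is none, any type will do.\<close>
  define B where "B = (case \<Gamma> x of None \<Rightarrow> Bot | Some C \<Rightarrow> C)"
  have "typing (case_nat (Some B) \<Gamma>) (ren (abstr x) id M) A \<Theta>"
    using ty by (rule typing_ren) (auto simp: abstr_def B_def)
  then have "typing \<Gamma> (lam x M) (Arr B A) \<Theta>"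
    unfolding lam_def by (rule typing.ty_Lam)
  then show ?thesis using fin by (auto simp: typable_def)
qed

lemma lam_WN:
  assumes "M \<in> WN UNIV"
  shows "lam x M \<in> WN UNIV"
proof -
  obtain N where "(step UNIV)\<^sup>*\<^sup>* M N" "nf N"
    using assms by (auto simp: WN_iff)
  then have "(step UNIV)\<^sup>*\<^sup>* (lam x M) (lam x N)" "nf (lam x N)"
    unfolding lam_def by (auto intro!: steps_Lam steps_ren)
  then show ?thesis by (auto simp: WN_iff)
qed

lemma mu_WN:
  assumes "M \<in> WN UNIV" and "mu a M \<in> typable"
  shows "mu a M \<in> WN UNIV"
proof -
  let ?ren = "ren id (abstr a)"
  obtain N where "(step UNIV)\<^sup>*\<^sup>* M N" and "nf N"
    using assms by (auto simp: WN_iff)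
  then have steps: "(step UNIV)\<^sup>*\<^sup>* (?ren M) (?ren N)"
    by (simp add: steps_ren)
  then have mu: "(step UNIV)\<^sup>*\<^sup>* (mu a M) (Mu (?ren N))"
    by (simp add: mu_def steps_Mu)
  show ?thesis
  proof (cases "is_mu N")
    case False
    then show ?thesis using mu \<open>nf N\<close> by (auto simp: WN_iff)
  next
    case True
    then obtain P where P: "?ren N = Mu P"
      by (metis is_mu_iff ren_shape(2))
    have "nf (Mu P)"
      unfolding P [symmetric] using \<open>nf N\<close> by simp
    obtain \<Gamma> A \<Theta> where "typing \<Gamma> (?ren M) Bot (case_nat (Some A) \<Theta>)"
      using assms(2) by (auto simp: typable_def mu_def elim: typing_MuE)
    \<comment> \<open>By subject reduction the inner \<open>Mu P\<close> has type \<bottom>, and so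
      has its bound variable, index 0 in \<open>P\<close>; this is what \<open>nf_erase\<close>
      requires.\<close>
    then have "typing \<Gamma> P Bot (case_nat (Some Bot) (case_nat (Some A) \<Theta>))"
      using steps_typing[OF steps] P by (auto elim: typing_MuE)
    then have "nf (erase P 0)" "\<not> is_mu (erase P 0)"
      using nf_erase[of \<Gamma> P Bot _ 0] \<open>nf (Mu P)\<close> by auto
    moreover have "step UNIV (Mu (Mu P)) (Mu (ren id (case_nat 0 id) (erase P 0)))"
      by (rule step.root[OF UNIV_I contr.Epsilon])
    ultimately show ?thesis
      using mu rtranclp.rtrancl_into_rtrancl[of "step UNIV"] unfolding P WN_iff
      by (metis nf.simps(5) nf_ren ren_shape(2))
  qed
qed

text \<open>If the normal form is a \<mu>-term, one \<rho>-step suffices: \<open>nf\<close> depends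
  on shapes only, so even a renaming that merges names preserves it.\<close>

lemma Nam_WN:
  assumes "M \<in> WN UNIV"
  shows "Nam a M \<in> WN UNIV"
proof -
  obtain N where "(step UNIV)\<^sup>*\<^sup>* M N" and "nf N"
    using assms by (auto simp: WN_iff)
  then have nam: "(step UNIV)\<^sup>*\<^sup>* (Nam a M) (Nam a N)"
    by (simp add: steps_Nam)
  show ?thesis
  proof (cases "is_mu N")
    case False
    then show ?thesis using nam \<open>nf N\<close> by (auto simp: WN_iff)
  next
    case True
    then obtain P where P: "N = Mu P"
      by (auto simp: is_mu_iff)
    have "step UNIV (Nam a N) (ren id (case_nat a id) P)"
      unfolding P by (rule step.root[OF UNIV_I contr.Rho])
    then have "(step UNIV)\<^sup>*\<^sup>* (Nam a M) (ren id (case_nat a id) P)"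
      using nam by (rule rtranclp.rtrancl_into_rtrancl[rotated])
    moreover have "nf (ren id (case_nat a id) P)"
      using \<open>nf N\<close> P by simp
    ultimately show ?thesis by (auto simp: WN_iff)
  qed
qed

text \<open>Each \<mu>-step absorbs the next argument and leaves a \<mu>-term at the head; freshness
  of \<open>a\<close> prevents capture.\<close>

lemma steps_apps_mu:
  assumes "\<forall>N\<in>set Ns. a \<notin> free_mvars N"
  shows "(step UNIV)\<^sup>*\<^sup>* (apps (mu a M) Ns) (mu a (msubsts_r M a Ns))"
  using assms
proof (induction Ns arbitrary: M)
  case Nil
  show ?case by (simp add: msubsts_r_def)
next
  case (Cons N Ns)
  have "step UNIV (apps (App (mu a M) N) Ns) (apps (mu a (msubst_r M a N)) Ns)"
    using Cons.prems by (intro step_apps step.root[OF UNIV_I contr_MuR]) simp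
  moreover have "(step UNIV)\<^sup>*\<^sup>* (apps (mu a (msubst_r M a N)) Ns) (mu a (msubsts_r M a (N # Ns)))"
    using Cons.IH[of "msubst_r M a N"] Cons.prems by (simp add: msubsts_r_def)
  ultimately show ?case by (simp add: converse_rtranclp_into_rtranclp)
qed

theorem theorem5p19: "saturated (WN {Beta, MuR, MuL, Rho, Epsilon} \<inter> typable)"
proof -
  have rules: "{Beta, MuR, MuL, Rho, Epsilon} = UNIV"
    by (auto intro: redrule.exhaust)
  have beta: "apps (App (lam x M) N) Ps \<in> WN UNIV" if "apps (subst M x N) Ps \<in> WN UNIV"
    for x M N Ps
    by (rule WN_expand[OF r_into_rtranclp that], rule step_apps, rule step.root[OF UNIV_I contr_Beta])
  have var: "apps (Var x) Ns \<in> WN UNIV" if "Ns \<in> lists (WN UNIV \<inter> typable)" for x Ns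
    using apps_Var_normalizes[of Ns x] that by (auto simp: WN_iff)
  show ?thesis
    unfolding rules saturated_def
  proof (intro conjI allI impI)
    fix a M Ns
    assume "\<forall>N\<in>set Ns. a \<notin> free_mvars N" "apps (mu a M) Ns \<in> typable"
      and "mu a (msubsts_r M a Ns) \<in> WN UNIV \<inter> typable"
    then show "apps (mu a M) Ns \<in> WN UNIV \<inter> typable"
      using WN_expand[OF steps_apps_mu] by blast
  qed (simp_all add: lam_typable lam_WN mu_WN Nam_WN var beta)
qed

end
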